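(* Let $p\in\mathcal{H}_{n,d}(e)$ be not SOS-hyperbolic with respect to $e\in\mathbb{R}^n$, and let $q\in\mathcal{H}_{n',1}(e')$ with $e'\in\mathbb{R}^{n'}$. Define, for $(x,x')\in\mathbb{R}^n\times\mathbb{R}^{n'}$, $$\tilde p(x,x')=q(e')p(x)+q(x')D_ep(x).$$ Then $\tilde p\in\mathcal{H}_{n+n',d}((e,0))$, and $\tilde p$ is not SOS-hyperbolic with respect to $(e,0)$.
   Context: A homogeneous polynomial $p\in\mathbb{R}[x_1,\ldots,x_n]$ of degree $d$ is hyperbolic with respect to $e\in\mathbb{R}^n$ if $p(e)>0$ and for every $x\in\mathbb{R}^n$ the polynomial $t\mapsto p(x+te)$ has only real zeros; $\mathcal{H}_{n,d}(e)$ is the set of such polynomials. The hyperbolicity cone $\Lambda_+(p,e)$ is the set of $x\in\mathbb{R}^n$ such that all zeros of $t\mapsto p(te-x)$ are nonnegative. $D_up(x)=\frac{d}{dt}p(x+tu)|_{t=0}$ is the directional derivative. For $x,u\in\mathbb{R}^n$ put $p_x(t)=p(x+te)$ and $D_up_x(t)=(D_up)(x+te)$. The parameterized Bézoutian $B_{p,e}(x)[u]$ is the $d\times d$ symmetric matrix (with entries polynomial in $x$) defined by $$\frac{p_x(t)\,D_up_x(s)-D_up_x(t)\,p_x(s)}{t-s}=\sum_{i,j=1}^d [B_{p,e}(x)[u]]_{ij}\,t^{i-1}s^{j-1}.$$ A symmetric matrix $P(x)$ with polynomial entries is a matrix sum of squares if $P(x)=Q(x)Q(x)^T$ for some (possibly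 rectangular) matrix $Q$ with real polynomial entries. $p\in\mathcal{H}_{n,d}(e)$ is SOS-hyperbolic with respect to $e$ if $B_{p,e}(x)[u]$ is a matrix sum of squares for every $u\in\Lambda_+(p,e)$. *)

theory Defs
  imports "HOL-Analysis.Analysis" "Jordan_Normal_Form.Matrix"
begin

text \<open>Real polynomials in \<open>n\<close> variables are identified with the polynomial functions they
  induce on an \<open>n\<close>-dimensional Euclidean space; as the reals are infinite, this loses nothing.
  For arbitrary polynomials the library predicate \<^const>\<open>real_polynomial_function\<close> is used. The
  coordinates of a vector \<open>x\<close> are \<open>inner x b\<close> for \<open>b \<in> Basis\<close>, so that \<open>'a \<times> 'b\<close> has the
  variables of \<open>'a\<close> together with those of \<open>'b\<close>.\<close>

definition exponents :: "nat \<Rightarrow> ('a::euclidean_space \<Rightarrow> nat) set" where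
  "exponents d = {\<alpha>. (\<forall>b. b \<notin> Basis \<longrightarrow> \<alpha> b = 0) \<and> (\<Sum>b\<in>Basis. \<alpha> b) = d}"

definition homogeneous_polynomial :: "nat \<Rightarrow> ('a::euclidean_space \<Rightarrow> real) \<Rightarrow> bool" where
  "homogeneous_polynomial d p \<longleftrightarrow>
     (\<exists>c. \<forall>x. p x = (\<Sum>\<alpha>\<in>exponents d. c \<alpha> * (\<Prod>b\<in>Basis. inner x b ^ \<alpha> b)))"

text \<open>The univariate polynomial \<open>t \<mapsto> p (x + t v)\<close>. It is unique, and it exists whenever \<open>p\<close> is a
  polynomial; it is needed as a formal object in order to speak of its complex zeros.\<close>

definition line_poly :: "('a::euclidean_space \<Rightarrow> real) \<Rightarrow> 'a \<Rightarrow> 'a \<Rightarrow> real poly" where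
  "line_poly p x v = (THE f. \<forall>t. poly f t = p (x + t *\<^sub>R v))"

definition complex_zeros :: "real poly \<Rightarrow> complex set" where
  "complex_zeros f = {z. poly (map_poly complex_of_real f) z = 0}"

definition hyperbolic_polys :: "nat \<Rightarrow> 'a::euclidean_space \<Rightarrow> ('a \<Rightarrow> real) set" where
  "hyperbolic_polys d e =
     {p. homogeneous_polynomial d p \<and> p e > 0 \<and> (\<forall>x. complex_zeros (line_poly p x e) \<subseteq> \<real>)}"

definition hyperbolicity_cone :: "('a::euclidean_space \<Rightarrow> real) \<Rightarrow> 'a \<Rightarrow> 'a set" where
  "hyperbolicity_cone p e = {x. complex_zeros (line_poly p (- x) e) \<subseteq> \<real>\<^sub>\<ge>\<^sub>0}"

definition dir_deriv :: "'a::euclidean_space \<Rightarrow> ('a \<Rightarrow> real) \<Rightarrow> 'a \<Rightarrow> real" where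
  "dir_deriv u p x = deriv (\<lambda>t. p (x + t *\<^sub>R u)) 0"

text \<open>Rows and columns are numbered from \<open>0\<close>, which absorbs the shift in the exponents
  \<open>i - 1\<close>, \<open>j - 1\<close> of the usual 1-based formula. The quotient by \<open>t - s\<close> is an identity of
  polynomials in \<open>t\<close> and \<open>s\<close>, hence determined by its values off the diagonal; at \<open>t = s\<close> the
  expression would be a division by zero. For \<open>p\<close> homogeneous of degree \<open>d\<close> there is exactly one
  such matrix.\<close>

definition bezoutian ::
  "nat \<Rightarrow> ('a::euclidean_space \<Rightarrow> real) \<Rightarrow> 'a \<Rightarrow> 'a \<Rightarrow> 'a \<Rightarrow> real mat" where
  "bezoutian d p e u x =
     (THE B. B \<in> carrier_mat d d \<and>
        (\<forall>t s. t \<noteq> s \<longrightarrow>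
           (p (x + t *\<^sub>R e) * dir_deriv u p (x + s *\<^sub>R e)
              - dir_deriv u p (x + t *\<^sub>R e) * p (x + s *\<^sub>R e)) / (t - s)
           = (\<Sum>i<d. \<Sum>j<d. B $$ (i, j) * t ^ i * s ^ j)))"

text \<open>Symmetry of \<open>P\<close> and polynomiality of its entries are implied by the equation.\<close>

definition matrix_sum_of_squares :: "nat \<Rightarrow> ('a::euclidean_space \<Rightarrow> real mat) \<Rightarrow> bool" where
  "matrix_sum_of_squares d P \<longleftrightarrow>
     (\<exists>k Q. (\<forall>x. Q x \<in> carrier_mat d k) \<and>
            (\<forall>i<d. \<forall>j<k. real_polynomial_function (\<lambda>x. Q x $$ (i, j))) \<and>
            (\<forall>x. P x = Q x * transpose_mat (Q x)))"

text \<open>Meant for \<open>p\<close> in \<open>hyperbolic_polys d e\<close>.\<close>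

definition SOS_hyperbolic :: "nat \<Rightarrow> ('a::euclidean_space \<Rightarrow> real) \<Rightarrow> 'a \<Rightarrow> bool" where
  "SOS_hyperbolic d p e \<longleftrightarrow>
     (\<forall>u\<in>hyperbolicity_cone p e. matrix_sum_of_squares d (bezoutian d p e u))"

end

theory Submission
  imports Defs "HOL-Computational_Algebra.Fundamental_Theorem_Algebra"
begin

text \<open>Write \<open>a = q(e') > 0\<close>. On the line \<open>t \<mapsto> (x + t e, x')\<close> the polynomial \<open>pt\<close> restricts to
  \<open>a f + b f'\<close>, where \<open>f(t) = p(x + t e)\<close> is real-rooted and \<open>b = q(x')\<close> is a real constant. At a
  non-real zero \<open>z\<close> of this combination one would have \<open>b f'(z)/f(z) = -a\<close>, a nonzero real
  number; but the imaginary part of \<open>f'(z)/f(z) = \<Sum>\<^sub>r 1/(z - r)\<close> vanishes only if \<open>f\<close> is constant,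
  and then \<open>f' = 0\<close>. So \<open>pt\<close> is hyperbolic (\<open>complex_zeros_add_pderiv\<close>). It is homogeneous of
  degree \<open>d\<close> because \<open>c D\<^sub>ep(c x) = c\<^sup>d D\<^sub>ep(x)\<close> (\<open>homogeneous_perturbation\<close>).

  Since \<open>q\<close> is linear, \<open>q(0) = 0\<close>, and \<open>pt(x, 0) = a p(x)\<close>. Hence \<open>u \<mapsto> (u, 0)\<close> maps the
  hyperbolicity cone of \<open>p\<close> into that of \<open>pt\<close>, and the Bezoutian of \<open>pt\<close> in direction \<open>(u, 0)\<close>
  at the point \<open>(x, 0)\<close> is \<open>a\<^sup>2\<close> times that of \<open>p\<close> in direction \<open>u\<close> at \<open>x\<close>
  (\<open>bezoutian_perturbation\<close>). Setting \<open>x' = 0\<close> in a matrix sum of squares and rescaling by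
  \<open>a\<^sup>-\<^sup>1\<close> therefore turns SOS-hyperbolicity of \<open>pt\<close> into that of \<open>p\<close>.

  As lines and Bezoutians are given by definite descriptions, the argument also needs their
  existence and uniqueness. For the \<open>d \<times> d\<close> Bezoutian this rests on the bound \<open>d\<close> for the degrees
  of \<open>p\<close> and \<open>D\<^sub>up\<close> on lines (\<open>degree_line_poly_homogeneous\<close>).\<close>

section \<open>Homogeneous polynomials\<close>

lemma finite_exponents: "finite (exponents d :: ('a::euclidean_space \<Rightarrow> nat) set)"
proof (rule finite_subset)
  let ?S = "{f::'a \<Rightarrow> nat. \<forall>b. (b \<in> Basis \<longrightarrow> f b \<in> {..d}) \<and> (b \<notin> Basis \<longrightarrow> f b = 0)}"
  show "finite ?S"
    by (intro finite_set_of_finite_funs) auto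
  show "exponents d \<subseteq> ?S"
  proof
    fix \<alpha> :: "'a \<Rightarrow> nat"
    assume "\<alpha> \<in> exponents d"
    then have 0: "\<forall>b. b \<notin> Basis \<longrightarrow> \<alpha> b = 0" and s: "(\<Sum>b\<in>Basis. \<alpha> b) = d"
      by (auto simp: exponents_def)
    have "\<alpha> b \<le> d" if "b \<in> Basis" for b
      using member_le_sum[of b Basis \<alpha>] that s by auto
    with 0 show "\<alpha> \<in> ?S"
      by auto
  qed
qed

lemma homogeneous_polynomial_zero: "homogeneous_polynomial d (\<lambda>x. 0)"
  unfolding homogeneous_polynomial_def by (rule exI[of _ "\<lambda>_. 0"]) simp

lemma homogeneous_polynomial_add:
  assumes "homogeneous_polynomial d f" "homogeneous_polynomial d g"
  shows "homogeneous_polynomial d (\<lambda>x. f x + g x)"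
proof -
  obtain c c' where "\<forall>x. f x = (\<Sum>\<alpha>\<in>exponents d. c \<alpha> * (\<Prod>b\<in>Basis. inner x b ^ \<alpha> b))"
    and "\<forall>x. g x = (\<Sum>\<alpha>\<in>exponents d. c' \<alpha> * (\<Prod>b\<in>Basis. inner x b ^ \<alpha> b))"
    using assms unfolding homogeneous_polynomial_def by blast
  then show ?thesis
    unfolding homogeneous_polynomial_def
    by (intro exI[of _ "\<lambda>\<alpha>. c \<alpha> + c' \<alpha>"]) (simp add: distrib_right sum.distrib)
qed

lemma homogeneous_polynomial_sum:
  assumes "\<And>i. i \<in> I \<Longrightarrow> homogeneous_polynomial d (f i)"
  shows "homogeneous_polynomial d (\<lambda>x. \<Sum>i\<in>I. f i x)"
  using assms
proof (induction I rule: infinite_finite_induct)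
  case (insert i I)
  then show ?case
    using homogeneous_polynomial_add[of d "f i" "\<lambda>x. \<Sum>i\<in>I. f i x"] by simp
qed (simp_all add: homogeneous_polynomial_zero)

lemma homogeneous_polynomial_monomial:
  assumes "\<alpha> \<in> exponents d"
  shows "homogeneous_polynomial d (\<lambda>x. c * (\<Prod>b\<in>Basis. inner x b ^ \<alpha> b))"
proof -
  have "(\<Sum>\<beta>\<in>exponents d. (if \<beta> = \<alpha> then c else 0) * (\<Prod>b\<in>Basis. inner x b ^ \<beta> b))
        = (\<Sum>\<beta>\<in>exponents d. if \<beta> = \<alpha> then c * (\<Prod>b\<in>Basis. inner x b ^ \<alpha> b) else 0)" for x
    by (intro sum.cong) auto
  then show ?thesis
    unfolding homogeneous_polynomial_def
    by (intro exI[of _ "\<lambda>\<beta>. if \<beta> = \<alpha> then c else 0"]) (simp add: assms finite_exponents)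
qed

lemma homogeneous_polynomial_mult:
  assumes "homogeneous_polynomial m f" "homogeneous_polynomial n g"
  shows "homogeneous_polynomial (m + n) (\<lambda>x. f x * g x)"
proof -
  obtain c c' where f: "\<And>x. f x = (\<Sum>\<alpha>\<in>exponents m. c \<alpha> * (\<Prod>b\<in>Basis. inner x b ^ \<alpha> b))"
    and g: "\<And>x. g x = (\<Sum>\<alpha>\<in>exponents n. c' \<alpha> * (\<Prod>b\<in>Basis. inner x b ^ \<alpha> b))"
    using assms unfolding homogeneous_polynomial_def by blast
  have "f x * g x = (\<Sum>\<alpha>\<in>exponents m. \<Sum>\<beta>\<in>exponents n.
          (c \<alpha> * c' \<beta>) * (\<Prod>b\<in>Basis. inner x b ^ (\<alpha> b + \<beta> b)))" for x
    unfolding f g sum_product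
    by (intro sum.cong refl) (simp add: power_add prod.distrib)
  moreover have "homogeneous_polynomial (m + n) (\<lambda>x. \<Sum>\<alpha>\<in>exponents m. \<Sum>\<beta>\<in>exponents n.
          (c \<alpha> * c' \<beta>) * (\<Prod>b\<in>Basis. inner x b ^ (\<alpha> b + \<beta> b)))"
    by (intro homogeneous_polynomial_sum homogeneous_polynomial_monomial)
      (auto simp: exponents_def sum.distrib)
  ultimately show ?thesis
    by presburger
qed

lemma homogeneous_polynomial_const: "homogeneous_polynomial 0 (\<lambda>x. c)"
  using homogeneous_polynomial_monomial[of "\<lambda>_. 0" 0 c] by (simp add: exponents_def)

lemma homogeneous_polynomial_linear:
  assumes "bounded_linear f"
  shows "homogeneous_polynomial 1 f"
proof -
  interpret bounded_linear f by fact
  define \<delta> :: "'a \<Rightarrow> 'a \<Rightarrow> nat" where "\<delta> b = (\<lambda>b'. if b' = b then 1 else 0)" for b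
  have eq: "f x = (\<Sum>b\<in>Basis. f b * (\<Prod>b'\<in>Basis. inner x b' ^ \<delta> b b'))" for x
  proof -
    have "(\<Prod>b'\<in>Basis. inner x b' ^ \<delta> b b') = inner x b" if "b \<in> Basis" for b
    proof -
      have "(\<Prod>b'\<in>Basis. inner x b' ^ \<delta> b b') = (\<Prod>b'\<in>Basis. if b' = b then inner x b else 1)"
        by (intro prod.cong) (auto simp: \<delta>_def)
      then show ?thesis
        using that by simp
    qed
    moreover have "f x = (\<Sum>b\<in>Basis. f b * inner x b)"
      by (subst euclidean_representation[of x, symmetric])
        (simp add: sum scale mult.commute del: euclidean_representation)
    ultimately show ?thesis
      by simp
  qed
  have "homogeneous_polynomial 1 (\<lambda>x. \<Sum>b\<in>Basis. f b * (\<Prod>b'\<in>Basis. inner x b' ^ \<delta> b b'))"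
    by (intro homogeneous_polynomial_sum homogeneous_polynomial_monomial)
      (auto simp: exponents_def \<delta>_def)
  then show ?thesis
    by (subst eq[abs_def])
qed

text \<open>The induction over polynomial functions produces the homogeneous components; in a product
  they are the Cauchy products of those of the factors.\<close>

lemma homogeneous_decomposition:
  assumes "real_polynomial_function (p :: 'a::euclidean_space \<Rightarrow> real)"
  shows "\<exists>N h. (\<forall>k. homogeneous_polynomial k (h k)) \<and> (\<forall>x. p x = (\<Sum>k\<le>N. h k x))"
  using assms
proof (induction rule: real_polynomial_function.induct)
  case (linear f)
  then have "homogeneous_polynomial 1 f"
    by (rule homogeneous_polynomial_linear)
  then show ?case
    by (intro exI[of _ 1] exI[of _ "\<lambda>k. if k = 1 then f else (\<lambda>x. 0)"])
      (auto simp: homogeneous_polynomial_zero)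
next
  case (const c)
  show ?case
    by (rule exI[of _ 0], rule exI[of _ "\<lambda>k. if k = 0 then (\<lambda>x. c) else (\<lambda>x. 0)"])
      (auto simp: homogeneous_polynomial_zero homogeneous_polynomial_const)
next
  case (add f g)
  then obtain M N h h' where h: "\<And>k. homogeneous_polynomial k (h k)" "\<And>x. f x = (\<Sum>k\<le>M. h k x)"
    and h': "\<And>k. homogeneous_polynomial k (h' k)" "\<And>x. g x = (\<Sum>k\<le>N. h' k x)"
    by metis
  let ?H = "\<lambda>k x. (if k \<le> M then h k x else 0) + (if k \<le> N then h' k x else 0)"
  have "homogeneous_polynomial k (?H k)" for k
    using h(1) h'(1) by (cases "k \<le> M"; cases "k \<le> N")
      (simp_all add: homogeneous_polynomial_zero homogeneous_polynomial_add)
  moreover have "f x + g x = (\<Sum>k\<le>M + N. ?H k x)" for x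
  proof -
    have "(\<Sum>k\<le>M + N. if k \<le> M then h k x else 0) = f x"
      unfolding h(2) by (rule sum.mono_neutral_cong_right) auto
    moreover have "(\<Sum>k\<le>M + N. if k \<le> N then h' k x else 0) = g x"
      unfolding h'(2) by (rule sum.mono_neutral_cong_right) auto
    ultimately show ?thesis
      by (simp add: sum.distrib)
  qed
  ultimately show ?case
    by (intro exI[of _ "M + N"] exI[of _ ?H]) blast
next
  case (mult f g)
  then obtain M N h h' where h: "\<And>k. homogeneous_polynomial k (h k)" "\<And>x. f x = (\<Sum>k\<le>M. h k x)"
    and h': "\<And>k. homogeneous_polynomial k (h' k)" "\<And>x. g x = (\<Sum>k\<le>N. h' k x)"
    by metis
  let ?I = "\<lambda>k. {ij \<in> {..M} \<times> {..N}. fst ij + snd ij = k}"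
  let ?H = "\<lambda>k x. \<Sum>ij\<in>?I k. h (fst ij) x * h' (snd ij) x"
  have "homogeneous_polynomial k (?H k)" for k
  proof (rule homogeneous_polynomial_sum)
    fix ij assume "ij \<in> ?I k"
    then show "homogeneous_polynomial k (\<lambda>x. h (fst ij) x * h' (snd ij) x)"
      using homogeneous_polynomial_mult[OF h(1) h'(1), of "fst ij" "snd ij"] by simp
  qed
  moreover have "f x * g x = (\<Sum>k\<le>M + N. ?H k x)" for x
  proof -
    have "f x * g x = (\<Sum>ij\<in>{..M} \<times> {..N}. h (fst ij) x * h' (snd ij) x)"
      by (simp add: h h' sum_product sum.cartesian_product case_prod_unfold)
    also have "\<dots> = (\<Sum>k\<le>M + N. ?H k x)"
      by (rule sum.group[symmetric]) auto
    finally show ?thesis .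
  qed
  ultimately show ?case
    by (intro exI[of _ "M + N"] exI[of _ ?H]) blast
qed

lemma poly_eq_if_eq_off_finite:
  fixes f g :: "real poly"
  assumes "finite S" "\<And>t. t \<notin> S \<Longrightarrow> poly f t = poly g t"
  shows "f = g"
proof (rule ccontr)
  assume "f \<noteq> g"
  then have "finite {t. poly (f - g) t = 0}"
    by (intro poly_roots_finite) simp
  moreover have "UNIV \<subseteq> S \<union> {t. poly (f - g) t = 0}"
    using assms(2) by auto
  ultimately show False
    using assms(1) infinite_UNIV_char_0[where ?'a = real] by (meson finite_UnI finite_subset)
qed

lemma homogeneous_polynomial_scale:
  assumes "homogeneous_polynomial d p"
  shows "p (r *\<^sub>R x) = r ^ d * p x"
proof -
  obtain c where p: "\<And>x. p x = (\<Sum>\<alpha>\<in>exponents d. c \<alpha> * (\<Prod>b\<in>Basis. inner x b ^ \<alpha> b))"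
    using assms unfolding homogeneous_polynomial_def by auto
  have "(\<Prod>b\<in>Basis. inner (r *\<^sub>R x) b ^ \<alpha> b) = r ^ d * (\<Prod>b\<in>Basis. inner x b ^ \<alpha> b)"
    if "\<alpha> \<in> exponents d" for \<alpha>
    using that by (simp add: exponents_def power_mult_distrib prod.distrib flip: power_sum)
  then show ?thesis
    unfolding p sum_distrib_left by (intro sum.cong) auto
qed

text \<open>With this characterisation the homogeneity of \<open>pt\<close> and the degree bounds on lines become a
  matter of scaling, without any handling of coefficients. The case \<open>c = 0\<close> is left out of the scaling condition; polynomiality
  makes it follow.\<close>

lemma homogeneous_polynomial_iff:
  fixes p :: "'a::euclidean_space \<Rightarrow> real"
  shows "homogeneous_polynomial d p \<longleftrightarrow>
    real_polynomial_function p \<and> (\<forall>c x. c \<noteq> 0 \<longrightarrow> p (c *\<^sub>R x) = c ^ d * p x)"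
proof (intro iffI conjI allI impI)
  assume "homogeneous_polynomial d p"
  then obtain c where p: "p = (\<lambda>x. \<Sum>\<alpha>\<in>exponents d. c \<alpha> * (\<Prod>b\<in>Basis. inner x b ^ \<alpha> b))"
    unfolding homogeneous_polynomial_def by auto
  show "real_polynomial_function p"
    unfolding p
    by (intro real_polynomial_function_sum real_polynomial_function.intros(4)
        real_polynomial_function.intros(2) real_polynomial_function_prod
        real_polynomial_function_power real_polynomial_function.intros(1)
        bounded_linear_inner_left finite_exponents finite_Basis)
  show "p (r *\<^sub>R x) = r ^ d * p x" for r x
    by (rule homogeneous_polynomial_scale) fact
next
  assume asm: "real_polynomial_function p \<and> (\<forall>c x. c \<noteq> 0 \<longrightarrow> p (c *\<^sub>R x) = c ^ d * p x)"
  then obtain N h where hom: "\<And>k. homogeneous_polynomial k (h k)"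
    and p: "\<And>x. p x = (\<Sum>k\<le>N. h k x)"
    using homogeneous_decomposition by metis
  \<comment> \<open>The component of degree \<open>d\<close> is all of \<open>p\<close>: compare coefficients in the scaling factor.\<close>
  have "p x = (if d \<le> N then h d x else 0)" for x
  proof -
    have "(\<Sum>k\<le>N. monom (h k x) k) = monom (p x) d"
    proof (rule poly_eq_if_eq_off_finite[of "{0}"])
      fix c :: real assume "c \<notin> {0}"
      then have "p (c *\<^sub>R x) = c ^ d * p x"
        using asm by auto
      then show "poly (\<Sum>k\<le>N. monom (h k x) k) c = poly (monom (p x) d) c"
        by (simp add: p[of "c *\<^sub>R x"] homogeneous_polynomial_scale[OF hom] poly_sum poly_monom mult_ac)
    qed simp
    then have "coeff (\<Sum>k\<le>N. monom (h k x) k) d = p x"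
      by simp
    then show ?thesis
      by (simp add: coeff_sum)
  qed
  then have "p = (if d \<le> N then h d else (\<lambda>x. 0))"
    by auto
  then show "homogeneous_polynomial d p"
    using hom homogeneous_polynomial_zero by auto
qed

section \<open>Restriction to lines and directional derivatives\<close>

lemma line_poly_exists:
  assumes "real_polynomial_function p"
  shows "\<exists>f. \<forall>t. poly f t = p (x + t *\<^sub>R v)"
  using assms
proof (induction rule: real_polynomial_function.induct)
  case (linear f)
  then interpret bounded_linear f .
  show ?case
    by (rule exI[of _ "[:f x, f v:]"]) (simp add: add scale)
next
  case (const c)
  show ?case
    by (rule exI[of _ "[:c:]"]) simp
next
  case (add f g)
  then show ?case
    by (metis poly_add)
next
  case (mult f g)
  then show ?case
    by (metis poly_mult)
qed

lemma line_poly_eqI: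
  assumes "\<And>t. poly f t = p (x + t *\<^sub>R v)"
  shows "line_poly p x v = f"
  unfolding line_poly_def
proof (rule the_equality)
  show "g = f" if "\<forall>t. poly g t = p (x + t *\<^sub>R v)" for g
    using that assms by (simp flip: poly_eq_poly_eq_iff add: fun_eq_iff)
qed (simp add: assms)

lemma poly_line_poly:
  assumes "real_polynomial_function p"
  shows "poly (line_poly p x v) t = p (x + t *\<^sub>R v)"
  using line_poly_exists[OF assms, of x v] line_poly_eqI[of _ p x v] by metis

lemma dir_deriv_line:
  assumes "real_polynomial_function p"
  shows "dir_deriv v p (x + t *\<^sub>R v) = poly (pderiv (line_poly p x v)) t"
proof -
  have "p (x + t *\<^sub>R v + s *\<^sub>R v) = poly (line_poly p x v) (t + s)" for s
    by (simp add: poly_line_poly[OF assms] scaleR_add_left add.assoc)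
  moreover have "((\<lambda>s. poly (line_poly p x v) (t + s)) has_field_derivative
      poly (pderiv (line_poly p x v)) t) (at 0)"
    by (auto intro!: derivative_eq_intros DERIV_chain'[OF _ poly_DERIV])
  ultimately show ?thesis
    unfolding dir_deriv_def by (simp add: DERIV_imp_deriv)
qed

lemma has_dir_deriv:
  assumes "real_polynomial_function p"
  shows "((\<lambda>t. p (x + t *\<^sub>R v)) has_real_derivative dir_deriv v p x) (at 0)"
proof -
  have "(poly (line_poly p x v) has_field_derivative poly (pderiv (line_poly p x v)) 0) (at 0)"
    by (rule poly_DERIV)
  then show ?thesis
    using dir_deriv_line[OF assms, of v x 0] by (simp add: poly_line_poly[OF assms, abs_def])
qed

lemma dir_derivI:
  "((\<lambda>t. p (x + t *\<^sub>R v)) has_real_derivative D) (at 0) \<Longrightarrow> dir_deriv v p x = D"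
  unfolding dir_deriv_def by (rule DERIV_imp_deriv)

lemma real_polynomial_function_dir_deriv:
  assumes "real_polynomial_function p"
  shows "real_polynomial_function (dir_deriv v p)"
  using assms
proof (induction rule: real_polynomial_function.induct)
  case (linear f)
  then interpret bounded_linear f .
  have "dir_deriv v f = (\<lambda>x. f v)"
    by (intro ext dir_derivI) (auto simp: add scale intro!: derivative_eq_intros)
  then show ?case
    by auto
next
  case (const c)
  have "dir_deriv v (\<lambda>x. c) = (\<lambda>x. 0)"
    by (intro ext dir_derivI) auto
  then show ?case
    by auto
next
  case (add f g)
  have "dir_deriv v (\<lambda>x. f x + g x) = (\<lambda>x. dir_deriv v f x + dir_deriv v g x)"
    by (intro ext dir_derivI DERIV_add has_dir_deriv add.hyps)
  then show ?case
    using add by auto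
next
  case (mult f g)
  have "dir_deriv v (\<lambda>x. f x * g x) = (\<lambda>x. dir_deriv v f x * g x + dir_deriv v g x * f x)"
  proof (intro ext dir_derivI)
    show "((\<lambda>t. f (x + t *\<^sub>R v) * g (x + t *\<^sub>R v)) has_real_derivative
        dir_deriv v f x * g x + dir_deriv v g x * f x) (at 0)" for x
      using DERIV_mult[OF has_dir_deriv[OF mult.hyps(1), of x v] has_dir_deriv[OF mult.hyps(2), of x v]]
      by simp
  qed
  then show ?case
    using mult by auto
qed

lemma dir_deriv_scale:
  assumes "homogeneous_polynomial d p" "c \<noteq> 0"
  shows "c * dir_deriv v p (c *\<^sub>R x) = c ^ d * dir_deriv v p x"
proof -
  have p: "real_polynomial_function p"
    and scale: "\<And>x. p (c *\<^sub>R x) = c ^ d * p x"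
    using assms by (auto simp: homogeneous_polynomial_iff)
  have "((\<lambda>t. p (c *\<^sub>R x + (c * t) *\<^sub>R v)) has_real_derivative dir_deriv v p (c *\<^sub>R x) * c) (at 0)"
    by (rule DERIV_chain2[of "\<lambda>t. p (c *\<^sub>R x + t *\<^sub>R v)"])
      (use has_dir_deriv[OF p, of "c *\<^sub>R x" v] in \<open>auto intro!: derivative_eq_intros\<close>)
  moreover have "p (c *\<^sub>R x + (c * t) *\<^sub>R v) = c ^ d * p (x + t *\<^sub>R v)" for t
    using scale[of "x + t *\<^sub>R v"] by (simp add: scaleR_add_right)
  moreover have "((\<lambda>t. c ^ d * p (x + t *\<^sub>R v)) has_real_derivative c ^ d * dir_deriv v p x) (at 0)"
    by (intro DERIV_cmult has_dir_deriv p)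
  ultimately show ?thesis
    using DERIV_unique by (metis (no_types, lifting) ext mult.commute)
qed

text \<open>For \<open>t \<noteq> 0\<close> the scaling hypothesis relates \<open>p(x + t v)\<close> to \<open>p(v + t\<^sup>-\<^sup>1 x)\<close>, whose reversal is
  again a polynomial in \<open>t\<close>. The factor \<open>c\<^sup>k\<close> is there for directional derivatives: these satisfy
  the hypothesis with \<open>k = 1\<close>, whatever \<open>d\<close> is, so that the truncated \<open>d - 1\<close> never occurs.\<close>

lemma degree_line_poly_le:
  assumes "real_polynomial_function p"
    and "\<And>c x. c \<noteq> 0 \<Longrightarrow> c ^ k * p (c *\<^sub>R x) = c ^ d * p x"
  shows "degree (line_poly p x v) \<le> d"
proof (cases "line_poly p x v = 0")
  case False
  define f where "f = line_poly p x v"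
  define h where "h = line_poly p v x"
  define m where "m = degree h"
  have "monom 1 (m + k) * f = monom 1 d * reflect_poly h"
  proof (rule poly_eq_if_eq_off_finite[of "{0}"])
    fix t :: real assume "t \<notin> {0}"
    then have t: "t \<noteq> 0"
      by simp
    have "p (t *\<^sub>R (v + inverse t *\<^sub>R x)) = poly f t"
      using t by (simp add: f_def poly_line_poly[OF assms(1)] scaleR_add_right add.commute)
    then have "t ^ k * poly f t = t ^ d * p (v + inverse t *\<^sub>R x)"
      using assms(2)[OF t, of "v + inverse t *\<^sub>R x"] by simp
    also have "p (v + inverse t *\<^sub>R x) = poly h (inverse t)"
      by (simp add: h_def poly_line_poly[OF assms(1)])
    finally show "poly (monom 1 (m + k) * f) t = poly (monom 1 d * reflect_poly h) t"
      using t by (simp add: poly_monom poly_reflect_poly_nz m_def power_add mult_ac)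
  qed simp
  moreover from this False have "reflect_poly h \<noteq> 0"
    by (auto simp: f_def monom_eq_0_iff)
  ultimately have "(m + k) + degree f = d + degree (reflect_poly h)"
    using False by (metis degree_monom_eq degree_mult_eq f_def monom_eq_0_iff zero_neq_one)
  then show ?thesis
    using degree_reflect_poly_le[of h] by (simp add: f_def m_def)
qed simp

lemma degree_line_poly_homogeneous:
  assumes "homogeneous_polynomial d p"
  shows "degree (line_poly p x v) \<le> d" "degree (line_poly (dir_deriv u p) x v) \<le> d"
proof -
  show "degree (line_poly p x v) \<le> d"
    using assms by (intro degree_line_poly_le[where k = 0]) (auto simp: homogeneous_polynomial_iff)
  show "degree (line_poly (dir_deriv u p) x v) \<le> d"
  proof (rule degree_line_poly_le[where k = 1])
    show "real_polynomial_function (dir_deriv u p)"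
      using assms by (auto simp: homogeneous_polynomial_iff real_polynomial_function_dir_deriv)
    show "c ^ 1 * dir_deriv u p (c *\<^sub>R x) = c ^ d * dir_deriv u p x" if "c \<noteq> 0" for c x
      using dir_deriv_scale[OF assms that] by simp
  qed
qed

section \<open>Bezout matrices\<close>

text \<open>Polynomial functions of two variables, of degree less than \<open>d\<close> in each of them: the
  functions that a \<open>d \<times> d\<close> coefficient matrix can represent.\<close>

definition bi_poly :: "nat \<Rightarrow> (real \<Rightarrow> real \<Rightarrow> real) \<Rightarrow> bool" where
  "bi_poly d F \<longleftrightarrow> (\<exists>C. \<forall>t s. F t s = (\<Sum>i<d. \<Sum>j<d. C i j * t ^ i * s ^ j))"

lemma bi_poly_zero: "bi_poly d (\<lambda>t s. 0)"
  unfolding bi_poly_def by (rule exI[of _ "\<lambda>_ _. 0"]) simp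

lemma bi_poly_cmult: "bi_poly d F \<Longrightarrow> bi_poly d (\<lambda>t s. c * F t s)"
proof -
  assume "bi_poly d F"
  then obtain C where "\<And>t s. F t s = (\<Sum>i<d. \<Sum>j<d. C i j * t ^ i * s ^ j)"
    unfolding bi_poly_def by blast
  then show ?thesis
    unfolding bi_poly_def
    by (intro exI[of _ "\<lambda>i j. c * C i j"]) (simp add: sum_distrib_left mult_ac)
qed

lemma bi_poly_add:
  assumes "bi_poly d F" "bi_poly d G"
  shows "bi_poly d (\<lambda>t s. F t s + G t s)"
proof -
  obtain C C' where "\<And>t s. F t s = (\<Sum>i<d. \<Sum>j<d. C i j * t ^ i * s ^ j)"
    and "\<And>t s. G t s = (\<Sum>i<d. \<Sum>j<d. C' i j * t ^ i * s ^ j)"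
    using assms unfolding bi_poly_def by blast
  then show ?thesis
    unfolding bi_poly_def
    by (intro exI[of _ "\<lambda>i j. C i j + C' i j"]) (simp add: distrib_right sum.distrib)
qed

lemma bi_poly_sum:
  assumes "\<And>i. i \<in> I \<Longrightarrow> bi_poly d (F i)"
  shows "bi_poly d (\<lambda>t s. \<Sum>i\<in>I. F i t s)"
  using assms
proof (induction I rule: infinite_finite_induct)
  case (insert i I)
  then show ?case
    using bi_poly_add[of d "F i" "\<lambda>t s. \<Sum>i\<in>I. F i t s"] by simp
qed (simp_all add: bi_poly_zero)

lemma bi_poly_monomial:
  assumes "a < d" "b < d"
  shows "bi_poly d (\<lambda>t s. t ^ a * s ^ b)"
proof -
  have "(\<Sum>i<d. \<Sum>j<d. (if i = a then if j = b then 1 else 0 else 0) * t ^ i * s ^ j)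
        = (\<Sum>i<d. if i = a then t ^ a * s ^ b else 0)" for t s :: real
  proof (intro sum.cong refl)
    fix i
    have "(\<Sum>j<d. (if i = a then if j = b then 1 else 0 else 0) * t ^ i * s ^ j)
        = (\<Sum>j<d. if j = b then if i = a then t ^ a * s ^ b else 0 else 0)"
      by (intro sum.cong) auto
    then show "(\<Sum>j<d. (if i = a then if j = b then 1 else 0 else 0) * t ^ i * s ^ j)
        = (if i = a then t ^ a * s ^ b else 0)"
      using assms by simp
  qed
  then show ?thesis
    unfolding bi_poly_def
    by (intro exI[of _ "\<lambda>i j. if i = a then if j = b then 1 else 0 else 0"]) (simp add: assms)
qed

lemma bezout_quotient_monomials:
  assumes "a \<le> d" "b \<le> d"
  shows "\<exists>G. bi_poly d G \<and> (\<forall>t s. t ^ a * s ^ b - t ^ b * s ^ a = (t - s) * G t s)"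
proof -
  have *: "\<exists>G. bi_poly d G \<and> (\<forall>t s. t ^ a * s ^ b - t ^ b * s ^ a = (t - s) * G t s)"
    if "b \<le> a" "a \<le> d" for a b
  proof -
    define n where "n = a - b"
    let ?G = "\<lambda>t s. \<Sum>k<n. t ^ (b + k) * (s::real) ^ (b + (n - Suc k))"
    have "bi_poly d ?G"
      using that by (intro bi_poly_sum bi_poly_monomial) (auto simp: n_def)
    moreover have "t ^ a * s ^ b - t ^ b * s ^ a = (t - s) * ?G t s" for t s
    proof -
      have "t ^ a * s ^ b - t ^ b * s ^ a = t ^ b * s ^ b * (t ^ n - s ^ n)"
        using that by (simp add: n_def algebra_simps flip: power_add)
      also have "\<dots> = (t - s) * ?G t s"
        unfolding power_diff_sumr2[of t n s] sum_distrib_left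
        by (intro sum.cong refl) (simp only: power_add mult_ac)
      finally show ?thesis .
    qed
    ultimately show ?thesis
      by blast
  qed
  show ?thesis
  proof (cases "b \<le> a")
    case False
    then obtain G where G: "bi_poly d G"
      "\<And>t s. t ^ b * s ^ a - t ^ a * s ^ b = (t - s) * G t s"
      using *[of a b] assms by auto
    have "t ^ a * s ^ b - t ^ b * s ^ a = (t - s) * (- 1 * G t s)" for t s
      using G(2)[of t s] by simp
    then show ?thesis
      using bi_poly_cmult[OF G(1), of "- 1"] by blast
  qed (use * assms in auto)
qed

text \<open>The numerator of the Bezoutian is bilinear in the coefficients of \<open>f\<close> and \<open>g\<close>, so
  divisibility by \<open>t - s\<close> reduces to monomials.\<close>

lemma bezout_quotient_exists:
  fixes f g :: "real poly"
  assumes "degree f \<le> d" "degree g \<le> d"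
  shows "\<exists>G. bi_poly d G \<and> (\<forall>t s. poly f t * poly g s - poly g t * poly f s = (t - s) * G t s)"
proof -
  define is_quotient where "is_quotient a b G \<longleftrightarrow>
      bi_poly d G \<and> (\<forall>t s. t ^ a * s ^ b - t ^ b * s ^ a = (t - s) * G t s)" for a b G
  define G where "G a b = (SOME G. is_quotient a b G)" for a b
  have "is_quotient a b (G a b)" if "a \<le> d" "b \<le> d" for a b
    unfolding G_def
    by (rule someI_ex[of "is_quotient a b"])
      (use bezout_quotient_monomials[OF that] in \<open>simp only: is_quotient_def\<close>)
  then have G: "bi_poly d (G a b)" "t ^ a * s ^ b - t ^ b * s ^ a = (t - s) * G a b t s"
    if "a \<le> d" "b \<le> d" for a b t s
    using that by (auto simp: is_quotient_def)
  have ev: "poly h t = (\<Sum>a\<le>d. coeff h a * t ^ a)" if "degree h \<le> d" for h :: "real poly" and t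
    unfolding poly_altdef
    by (rule sum.mono_neutral_left) (use that in \<open>auto simp: coeff_eq_0\<close>)
  let ?H = "\<lambda>t s. \<Sum>a\<le>d. \<Sum>b\<le>d. coeff f a * coeff g b * G a b t s"
  have "bi_poly d ?H"
    by (intro bi_poly_sum bi_poly_cmult G) auto
  moreover have "poly f t * poly g s - poly g t * poly f s = (t - s) * ?H t s" for t s
  proof -
    have "poly f t * poly g s = (\<Sum>a\<le>d. \<Sum>b\<le>d. coeff f a * coeff g b * (t ^ a * s ^ b))"
      unfolding ev[OF assms(1)] ev[OF assms(2)] sum_product
      by (intro sum.cong refl) (simp add: mult_ac)
    moreover have "poly g t * poly f s = (\<Sum>a\<le>d. \<Sum>b\<le>d. coeff f a * coeff g b * (t ^ b * s ^ a))"
      unfolding ev[OF assms(1)] ev[OF assms(2)] sum_product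
      by (subst sum.swap, intro sum.cong refl) (simp add: mult_ac)
    ultimately have "poly f t * poly g s - poly g t * poly f s
        = (\<Sum>a\<le>d. \<Sum>b\<le>d. coeff f a * coeff g b * (t ^ a * s ^ b - t ^ b * s ^ a))"
      by (simp only: right_diff_distrib sum_subtractf)
    also have "\<dots> = (\<Sum>a\<le>d. \<Sum>b\<le>d. coeff f a * coeff g b * ((t - s) * G a b t s))"
      by (intro sum.cong refl) (simp add: G(2))
    also have "\<dots> = (t - s) * ?H t s"
      unfolding sum_distrib_left by (intro sum.cong refl) (simp only: mult_ac)
    finally show ?thesis .
  qed
  ultimately show ?thesis
    by blast
qed

lemma coeffs_eq_if_eq_off_finite:
  fixes a b :: "nat \<Rightarrow> real"
  assumes "finite S" "\<And>t. t \<notin> S \<Longrightarrow> (\<Sum>i<d. a i * t ^ i) = (\<Sum>i<d. b i * t ^ i)" "i < d"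
  shows "a i = b i"
proof -
  have "(\<Sum>i<d. monom (a i) i) = (\<Sum>i<d. monom (b i) i)"
    by (rule poly_eq_if_eq_off_finite[OF assms(1)]) (simp add: poly_sum poly_monom assms(2))
  then have "coeff (\<Sum>i<d. monom (a i) i) i = coeff (\<Sum>i<d. monom (b i) i) i"
    by simp
  then show ?thesis
    using assms(3) by (simp add: coeff_sum)
qed

text \<open>Values off the diagonal suffice: for fixed \<open>s\<close> only the value \<open>t = s\<close> is missing.\<close>

lemma bi_poly_coeffs_unique:
  fixes A B :: "real mat"
  assumes "A \<in> carrier_mat d d" "B \<in> carrier_mat d d"
    and eq: "\<And>t s. t \<noteq> s \<Longrightarrow>
      (\<Sum>i<d. \<Sum>j<d. A $$ (i, j) * t ^ i * s ^ j) = (\<Sum>i<d. \<Sum>j<d. B $$ (i, j) * t ^ i * s ^ j)"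
  shows "A = B"
proof (rule eq_matI)
  fix i j assume "i < dim_row B" "j < dim_col B"
  then have i: "i < d" and j: "j < d"
    using assms by auto
  have "(\<Sum>j<d. A $$ (i, j) * s ^ j) = (\<Sum>j<d. B $$ (i, j) * s ^ j)" for s
  proof (rule coeffs_eq_if_eq_off_finite[where S = "{s}" and d = d and i = i])
    fix t assume "t \<notin> {s}"
    have factor: "(\<Sum>j<d. M $$ (i, j) * s ^ j) * t ^ i = (\<Sum>j<d. M $$ (i, j) * t ^ i * s ^ j)"
      for M :: "real mat" and i
      unfolding sum_distrib_right by (intro sum.cong refl) (simp only: mult_ac)
    from \<open>t \<notin> {s}\<close> have "(\<Sum>i<d. \<Sum>j<d. A $$ (i, j) * t ^ i * s ^ j)
        = (\<Sum>i<d. \<Sum>j<d. B $$ (i, j) * t ^ i * s ^ j)"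
      by (intro eq) simp
    then show "(\<Sum>i<d. (\<Sum>j<d. A $$ (i, j) * s ^ j) * t ^ i)
        = (\<Sum>i<d. (\<Sum>j<d. B $$ (i, j) * s ^ j) * t ^ i)"
      by (simp only: factor)
  qed (use i in auto)
  then show "A $$ (i, j) = B $$ (i, j)"
    using coeffs_eq_if_eq_off_finite[of "{}" "\<lambda>j. A $$ (i, j)" d "\<lambda>j. B $$ (i, j)" j] j by simp
qed (use assms in auto)

lemma bezoutian_eqI:
  assumes "B \<in> carrier_mat d d"
    and "\<And>t s. t \<noteq> s \<Longrightarrow>
      (p (x + t *\<^sub>R e) * dir_deriv u p (x + s *\<^sub>R e)
        - dir_deriv u p (x + t *\<^sub>R e) * p (x + s *\<^sub>R e)) / (t - s)
      = (\<Sum>i<d. \<Sum>j<d. B $$ (i, j) * t ^ i * s ^ j)"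
  shows "bezoutian d p e u x = B"
  unfolding bezoutian_def
proof (rule the_equality)
  fix A assume "A \<in> carrier_mat d d \<and> (\<forall>t s. t \<noteq> s \<longrightarrow>
      (p (x + t *\<^sub>R e) * dir_deriv u p (x + s *\<^sub>R e)
        - dir_deriv u p (x + t *\<^sub>R e) * p (x + s *\<^sub>R e)) / (t - s)
      = (\<Sum>i<d. \<Sum>j<d. A $$ (i, j) * t ^ i * s ^ j))"
  then show "A = B"
    using assms by (intro bi_poly_coeffs_unique[of A d B]) auto
qed (use assms in auto)

lemma
  assumes "homogeneous_polynomial d p"
  shows bezoutian_carrier: "bezoutian d p e u x \<in> carrier_mat d d"
    and bezoutian_identity: "t \<noteq> s \<Longrightarrow>
      (p (x + t *\<^sub>R e) * dir_deriv u p (x + s *\<^sub>R e)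
        - dir_deriv u p (x + t *\<^sub>R e) * p (x + s *\<^sub>R e)) / (t - s)
      = (\<Sum>i<d. \<Sum>j<d. bezoutian d p e u x $$ (i, j) * t ^ i * s ^ j)"
proof -
  have p: "real_polynomial_function p"
    using assms by (simp add: homogeneous_polynomial_iff)
  obtain G where G: "bi_poly d G" "\<And>t s. p (x + t *\<^sub>R e) * dir_deriv u p (x + s *\<^sub>R e)
      - dir_deriv u p (x + t *\<^sub>R e) * p (x + s *\<^sub>R e) = (t - s) * G t s"
    using bezout_quotient_exists[OF degree_line_poly_homogeneous(1,2)[OF assms], of x e u x e]
    by (auto simp: poly_line_poly p real_polynomial_function_dir_deriv)
  from G(1) obtain C where C: "\<And>t s. G t s = (\<Sum>i<d. \<Sum>j<d. C i j * t ^ i * s ^ j)"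
    unfolding bi_poly_def by blast
  have B: "(p (x + t *\<^sub>R e) * dir_deriv u p (x + s *\<^sub>R e)
        - dir_deriv u p (x + t *\<^sub>R e) * p (x + s *\<^sub>R e)) / (t - s)
      = (\<Sum>i<d. \<Sum>j<d. mat d d (case_prod C) $$ (i, j) * t ^ i * s ^ j)"
    if "t \<noteq> s" for t s
    using that by (simp add: G(2) C)
  have eq: "bezoutian d p e u x = mat d d (case_prod C)"
    by (rule bezoutian_eqI[OF _ B]) auto
  show "bezoutian d p e u x \<in> carrier_mat d d"
    by (simp add: eq)
  show "(p (x + t *\<^sub>R e) * dir_deriv u p (x + s *\<^sub>R e)
        - dir_deriv u p (x + t *\<^sub>R e) * p (x + s *\<^sub>R e)) / (t - s)
      = (\<Sum>i<d. \<Sum>j<d. bezoutian d p e u x $$ (i, j) * t ^ i * s ^ j)" if "t \<noteq> s"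
    unfolding eq by (rule B[OF that])
qed

section \<open>Real-rootedness\<close>

text \<open>The quotient \<open>f' / f\<close> at \<open>z\<close> is the sum of the \<open>1 / (z - r)\<close> over the roots \<open>r\<close> of \<open>f\<close>, with
  multiplicity. If all of these are real, then each summand has an imaginary part of sign
  opposite to that of \<open>Im z\<close>.\<close>

lemma Im_log_deriv_real_rooted:
  fixes f :: "complex poly"
  assumes "\<And>w. poly f w = 0 \<Longrightarrow> w \<in> \<real>" "Im z \<noteq> 0"
  shows "Im z * Im (poly (pderiv f) z / poly f z) \<le> 0
    \<and> (degree f > 0 \<longrightarrow> Im z * Im (poly (pderiv f) z / poly f z) < 0)"
  using assms(1)
proof (induction "degree f" arbitrary: f)
  case 0
  then have "pderiv f = 0"
    by (simp add: pderiv_eq_0_iff)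
  then show ?case
    using 0 by simp
next
  case (Suc n)
  then have "\<not> constant (poly f)"
    by (simp add: constant_degree)
  then obtain r where "poly f r = 0"
    using fundamental_theorem_of_algebra by blast
  then obtain g where f: "f = [:- r, 1:] * g"
    by (auto simp: poly_eq_0_iff_dvd)
  have "r \<in> \<real>"
    using Suc.prems \<open>poly f r = 0\<close> .
  then have r: "Im r = 0"
    by (simp add: complex_is_Real_iff)
  have "g \<noteq> 0"
    using Suc.hyps(2) f by auto
  then have "degree f = Suc (degree g)"
    unfolding f by (subst degree_mult_eq) auto
  then have IH: "Im z * Im (poly (pderiv g) z / poly g z) \<le> 0"
    using Suc.hyps Suc.prems by (simp add: f)
  have "poly f z \<noteq> 0"
    using Suc.prems[of z] assms(2) by (auto simp: complex_is_Real_iff)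
  then have nz: "z - r \<noteq> 0" "poly g z \<noteq> 0"
    by (auto simp: f)
  have "poly (pderiv f) z / poly f z = 1 / (z - r) + poly (pderiv g) z / poly g z"
  proof -
    have "poly (pderiv f) z = (z - r) * poly (pderiv g) z + poly g z"
      unfolding f pderiv_mult poly_add poly_mult by (simp add: pderiv_pCons)
    moreover have "poly f z = (z - r) * poly g z"
      by (simp add: f algebra_simps)
    ultimately show ?thesis
      using nz by (simp add: add_divide_distrib)
  qed
  moreover have "Im z * Im (1 / (z - r)) < 0"
  proof -
    have "Im (1 / (z - r)) = - Im z / (cmod (z - r))\<^sup>2"
      using r by (simp add: Im_divide cmod_power2)
    then show ?thesis
      using nz(1) assms(2) by (simp add: divide_less_0_iff zero_less_mult_iff linorder_neq_iff)
        (auto simp: field_simps zero_less_mult_iff)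
  qed
  ultimately show ?case
    using IH by (simp add: distrib_left)
qed

lemma complex_zeros_add_pderiv:
  assumes "complex_zeros f \<subseteq> \<real>" "a \<noteq> 0"
  shows "complex_zeros (Polynomial.smult a f + Polynomial.smult b (pderiv f)) \<subseteq> \<real>"
proof
  fix z assume z: "z \<in> complex_zeros (Polynomial.smult a f + Polynomial.smult b (pderiv f))"
  define F where "F = map_poly complex_of_real f"
  have F: "\<And>w. poly F w = 0 \<Longrightarrow> w \<in> \<real>"
    using assms(1) by (auto simp: complex_zeros_def F_def)
  have "map_poly complex_of_real (Polynomial.smult a f + Polynomial.smult b (pderiv f))
      = Polynomial.smult (of_real a) F + Polynomial.smult (of_real b) (pderiv F)"
    by (rule poly_eqI) (simp add: F_def coeff_map_poly coeff_pderiv)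
  then have eq: "of_real a * poly F z + of_real b * poly (pderiv F) z = 0"
    using z by (simp add: complex_zeros_def)
  show "z \<in> \<real>"
  proof (rule ccontr)
    assume "z \<notin> \<real>"
    then have Im: "Im z \<noteq> 0" and nz: "poly F z \<noteq> 0"
      using F[of z] by (auto simp: complex_is_Real_iff)
    define w where "w = poly (pderiv F) z / poly F z"
    have eq': "of_real b * w = - of_real a"
      using eq nz by (simp add: w_def field_simps add_eq_0_iff)
    have "b * Im w = 0"
      using arg_cong[OF eq', of Im] by simp
    moreover have "b \<noteq> 0"
      using eq' assms(2) by auto
    ultimately have "degree F = 0"
      using Im_log_deriv_real_rooted[of F z] F Im by (auto simp: w_def)
    then have "pderiv F = 0"
      by (simp add: pderiv_eq_0_iff)
    then show False
      using eq nz assms(2) by simp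
  qed
qed

lemma complex_zeros_smult:
  assumes "a \<noteq> 0"
  shows "complex_zeros (Polynomial.smult a f) = complex_zeros f"
proof -
  have "map_poly complex_of_real (Polynomial.smult a f)
      = Polynomial.smult (of_real a) (map_poly complex_of_real f)"
    by (rule poly_eqI) (simp add: coeff_map_poly)
  then show ?thesis
    using assms by (simp add: complex_zeros_def)
qed

section \<open>The perturbed polynomial\<close>

lemma line_poly_perturbation:
  assumes "real_polynomial_function p"
    and "\<And>x x'. pt (x, x') = a * p x + q x' * dir_deriv e p x"
  shows "line_poly pt (x, x') (e, 0)
    = Polynomial.smult a (line_poly p x e) + Polynomial.smult (q x') (pderiv (line_poly p x e))"
  by (rule line_poly_eqI) (simp add: assms(2) poly_line_poly[OF assms(1)] dir_deriv_line[OF assms(1)])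

lemma homogeneous_perturbation:
  fixes p :: "'a::euclidean_space \<Rightarrow> real" and q :: "'b::euclidean_space \<Rightarrow> real"
  assumes p: "homogeneous_polynomial d p" and q: "homogeneous_polynomial 1 q"
    and pt: "\<And>x x'. pt (x, x') = a * p x + q x' * dir_deriv e p x"
  shows "homogeneous_polynomial d pt"
  unfolding homogeneous_polynomial_iff
proof (intro conjI allI impI)
  have pol: "real_polynomial_function p" "real_polynomial_function q"
    using p q by (auto simp: homogeneous_polynomial_iff)
  have "real_polynomial_function (\<lambda>z. a * (p \<circ> fst) z + (q \<circ> snd) z * (dir_deriv e p \<circ> fst) z)"
    by (intro real_polynomial_function.intros(2-4) real_polynomial_function_compose pol
        real_polynomial_function_dir_deriv polynomial_function_bounded_linear
        bounded_linear_fst bounded_linear_snd)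
  moreover have "pt = (\<lambda>z. a * (p \<circ> fst) z + (q \<circ> snd) z * (dir_deriv e p \<circ> fst) z)"
    by (simp add: fun_eq_iff pt)
  ultimately show "real_polynomial_function pt"
    by simp
  fix c :: real and z :: "'a \<times> 'b" assume c: "c \<noteq> 0"
  obtain x x' where z: "z = (x, x')"
    by fastforce
  \<comment> \<open>The factor \<open>c\<close> that \<open>q\<close> contributes makes up for the degree lost by differentiation.\<close>
  have "q (c *\<^sub>R x') * dir_deriv e p (c *\<^sub>R x) = q x' * (c * dir_deriv e p (c *\<^sub>R x))"
    using q c by (simp add: homogeneous_polynomial_iff)
  also have "\<dots> = c ^ d * (q x' * dir_deriv e p x)"
    by (simp add: dir_deriv_scale[OF p c])
  finally show "pt (c *\<^sub>R z) = c ^ d * pt z"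
    using p c by (simp add: z pt homogeneous_polynomial_iff distrib_left)
qed

lemma homogeneous_1_at_0: "homogeneous_polynomial 1 q \<Longrightarrow> q 0 = 0"
  using homogeneous_polynomial_scale[of 1 q 0 0] by simp

text \<open>Only the slice \<open>x' = 0\<close> and directions along it are involved, where \<open>pt\<close> is \<open>a p\<close>.\<close>

lemma bezoutian_perturbation:
  fixes q :: "'b::euclidean_space \<Rightarrow> real"
  assumes p: "homogeneous_polynomial d p" and q: "q 0 = 0"
    and pt: "\<And>x x'. pt (x, x') = a * p x + q x' * dir_deriv e p x"
  shows "bezoutian d pt (e, 0) (u, 0) (x, 0) = a\<^sup>2 \<cdot>\<^sub>m bezoutian d p e u x"
proof (rule bezoutian_eqI)
  have pol: "real_polynomial_function p"
    using p by (simp add: homogeneous_polynomial_iff)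
  show "a\<^sup>2 \<cdot>\<^sub>m bezoutian d p e u x \<in> carrier_mat d d"
    using bezoutian_carrier[OF p] by simp
  have pt0: "pt (y, 0) = a * p y" for y
    by (simp add: pt q)
  have dir: "dir_deriv (u, 0) pt (y, 0) = a * dir_deriv u p y" for y
    by (rule dir_derivI) (simp add: pt0 DERIV_cmult has_dir_deriv[OF pol])
  fix t s :: real assume ts: "t \<noteq> s"
  have "(\<Sum>i<d. \<Sum>j<d. (a\<^sup>2 \<cdot>\<^sub>m bezoutian d p e u x) $$ (i, j) * t ^ i * s ^ j)
      = a\<^sup>2 * (\<Sum>i<d. \<Sum>j<d. bezoutian d p e u x $$ (i, j) * t ^ i * s ^ j)"
    unfolding sum_distrib_left
    by (intro sum.cong refl) (use bezoutian_carrier[OF p, of e u x] in auto)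
  then show "(pt ((x, 0) + t *\<^sub>R (e, 0)) * dir_deriv (u, 0) pt ((x, 0) + s *\<^sub>R (e, 0))
      - dir_deriv (u, 0) pt ((x, 0) + t *\<^sub>R (e, 0)) * pt ((x, 0) + s *\<^sub>R (e, 0))) / (t - s)
      = (\<Sum>i<d. \<Sum>j<d. (a\<^sup>2 \<cdot>\<^sub>m bezoutian d p e u x) $$ (i, j) * t ^ i * s ^ j)"
    unfolding bezoutian_identity[OF p ts, symmetric]
    by (simp add: pt0 dir power2_eq_square algebra_simps)
qed

lemma matrix_sum_of_squares_pullback:
  assumes "matrix_sum_of_squares d P" "polynomial_function h"
  shows "matrix_sum_of_squares d (\<lambda>x. P (h x))"
proof -
  obtain k Q where Q: "\<And>x. Q x \<in> carrier_mat d k"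
    "\<And>i j. i < d \<Longrightarrow> j < k \<Longrightarrow> real_polynomial_function (\<lambda>x. Q x $$ (i, j))"
    "\<And>x. P x = Q x * transpose_mat (Q x)"
    using assms(1) unfolding matrix_sum_of_squares_def by metis
  have "real_polynomial_function (\<lambda>x. Q (h x) $$ (i, j))" if "i < d" "j < k" for i j
    using real_polynomial_function_compose[OF assms(2) Q(2)[OF that]] by (simp add: o_def)
  then show ?thesis
    unfolding matrix_sum_of_squares_def using Q
    by (intro exI[of _ k] exI[of _ "\<lambda>x. Q (h x)"]) auto
qed

lemma matrix_sum_of_squares_smult:
  assumes "matrix_sum_of_squares d P"
  shows "matrix_sum_of_squares d (\<lambda>x. c\<^sup>2 \<cdot>\<^sub>m P x)"
proof -
  obtain k Q where Q: "\<And>x. Q x \<in> carrier_mat d k"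
    "\<And>i j. i < d \<Longrightarrow> j < k \<Longrightarrow> real_polynomial_function (\<lambda>x. Q x $$ (i, j))"
    "\<And>x. P x = Q x * transpose_mat (Q x)"
    using assms unfolding matrix_sum_of_squares_def by metis
  have "real_polynomial_function (\<lambda>x. (c \<cdot>\<^sub>m Q x) $$ (i, j))" if "i < d" "j < k" for i j
  proof -
    have "(c \<cdot>\<^sub>m Q x) $$ (i, j) = c * Q x $$ (i, j)" for x
      using Q(1)[of x] that by auto
    then show ?thesis
      using Q(2)[OF that] by auto
  qed
  moreover have "c\<^sup>2 \<cdot>\<^sub>m P x = (c \<cdot>\<^sub>m Q x) * transpose_mat (c \<cdot>\<^sub>m Q x)" for x
    unfolding Q(3)
    by (rule eq_matI) (use Q(1)[of x] in \<open>auto simp: power2_eq_square row_smult col_smult\<close>)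
  ultimately show ?thesis
    unfolding matrix_sum_of_squares_def using Q
    by (intro exI[of _ k] exI[of _ "\<lambda>x. c \<cdot>\<^sub>m Q x"]) auto
qed

section \<open>Hyperbolicity without SOS-hyperbolicity\<close>

theorem proposition4p13:
  fixes p :: "real ^ 'n \<Rightarrow> real" and e :: "real ^ 'n"
    and q :: "real ^ 'm \<Rightarrow> real" and e' :: "real ^ 'm"
    and d :: nat
    and pt :: "(real ^ 'n) \<times> (real ^ 'm) \<Rightarrow> real"
  assumes "p \<in> hyperbolic_polys d e"
    and "\<not> SOS_hyperbolic d p e"
    and "q \<in> hyperbolic_polys 1 e'"
    and "\<And>x x'. pt (x, x') = q e' * p x + q x' * dir_deriv e p x"
  shows "pt \<in> hyperbolic_polys d (e, 0) \<and> \<not> SOS_hyperbolic d pt (e, 0)"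
proof
  note pt = assms(4)
  have p: "homogeneous_polynomial d p" "p e > 0" "\<And>x. complex_zeros (line_poly p x e) \<subseteq> \<real>"
    using assms(1) by (auto simp: hyperbolic_polys_def)
  have q: "homogeneous_polynomial 1 q" "q e' > 0"
    using assms(3) by (auto simp: hyperbolic_polys_def)
  have pol: "real_polynomial_function p"
    using p(1) by (simp add: homogeneous_polynomial_iff)
  have q0: "q 0 = 0"
    using q(1) by (rule homogeneous_1_at_0)
  have line: "line_poly pt (x, x') (e, 0)
      = Polynomial.smult (q e') (line_poly p x e) + Polynomial.smult (q x') (pderiv (line_poly p x e))"
    for x x'
    by (rule line_poly_perturbation[OF pol pt])
  show "pt \<in> hyperbolic_polys d (e, 0)"
    unfolding hyperbolic_polys_def
  proof (intro CollectI conjI allI)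
    show "homogeneous_polynomial d pt"
      by (rule homogeneous_perturbation[OF p(1) q(1) pt])
    show "pt (e, 0) > 0"
      using p(2) q(2) by (simp add: pt q0)
    show "complex_zeros (line_poly pt z (e, 0)) \<subseteq> \<real>" for z
      using complex_zeros_add_pderiv[OF p(3)] q(2) by (cases z) (simp add: line)
  qed
  show "\<not> SOS_hyperbolic d pt (e, 0)"
  proof
    assume sos: "SOS_hyperbolic d pt (e, 0)"
    have "matrix_sum_of_squares d (bezoutian d p e u)" if u: "u \<in> hyperbolicity_cone p e" for u
    proof -
      have "line_poly pt (- (u, 0)) (e, 0) = Polynomial.smult (q e') (line_poly p (- u) e)"
        by (simp add: line q0)
      then have "(u, 0) \<in> hyperbolicity_cone pt (e, 0)"
        using u q(2) by (simp add: hyperbolicity_cone_def complex_zeros_smult)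
      then have "matrix_sum_of_squares d (bezoutian d pt (e, 0) (u, 0))"
        using sos by (simp add: SOS_hyperbolic_def)
      then have "matrix_sum_of_squares d (\<lambda>x. bezoutian d pt (e, 0) (u, 0) (x, 0))"
        by (rule matrix_sum_of_squares_pullback)
          (intro polynomial_function_bounded_linear bounded_linear_Pair
            bounded_linear_ident bounded_linear_zero)
      then have "matrix_sum_of_squares d (\<lambda>x. (q e')\<^sup>2 \<cdot>\<^sub>m bezoutian d p e u x)"
        by (simp add: bezoutian_perturbation[OF p(1) q0 pt])
      then have "matrix_sum_of_squares d (\<lambda>x. (inverse (q e'))\<^sup>2 \<cdot>\<^sub>m ((q e')\<^sup>2 \<cdot>\<^sub>m bezoutian d p e u x))"
        by (rule matrix_sum_of_squares_smult)
      moreover have "(inverse (q e'))\<^sup>2 \<cdot>\<^sub>m ((q e')\<^sup>2 \<cdot>\<^sub>m A) = A" for A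
        by (rule eq_matI) (use q(2) in \<open>auto simp: power_inverse\<close>)
      ultimately show ?thesis
        by simp
    qed
    then show False
      using assms(2) by (simp add: SOS_hyperbolic_def)
  qed
qed

end
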